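(* In the category $\mathbf{Sets}$ of sets, for each set $X$ let $K(X)$ be the collection of families of maps $\{A_\alpha\to X\}_{\alpha\in\mathcal{A}}$ such that the induced map $\coprod_{\alpha\in\mathcal{A}}A_\alpha\to X$ is a surjection. Then $K$ is a Grothendieck basis generating the canonical topology on $\mathbf{Sets}$. In particular, a sieve of the form $S=\langle\{A_\alpha\to X\}_{\alpha\in\mathcal{A}}\rangle$ on $X$ is in the canonical topology if and only if $\coprod_{\alpha\in\mathcal{A}}A_\alpha\to X$ is a surjection. Moreover, every colim sieve in $\mathbf{Sets}$ is a universal colim sieve.
   Context: A sieve $S$ on an object $X$ of a category is a collection of morphisms with codomain $X$ closed under precomposition; it is regarded as a full subcategory of the overcategory of $X$, with forgetful functor $U$ sending a morphism to its domain. For $f\colon Y\to X$, $f^\ast S=\{h \text{ with codomain } Y : f\circ h\in S\}$. $\langle\{A_\alpha\to X\}\rangle$ denotes the sieve generated by the family, i.e. all morphisms to $X$ factoring through a member of the family. $S$ is a colim sieve if $\operatorname{colim}_S U$ exists and the canonical map $\operatorname{colim}_S U\to X$ is an isomorphism; it is a universal colim sieve if $\alpha^\ast S$ is a colim sieve on $Y$ for every morphism $\alpha\colon Y\to X$. The canonical topology is the largest Grothendieck topology for which all representable presheaves are sheaves (equivalently, the collection of all universal colim sieves). A Grothendieck basis is a basis for a Grothendieck topology (pretopology) in the sense of Mac Lane–Moerdijk; it generates the topology whose covering sieves are those containing a family in the basis. *)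

theory Defs
  imports "HOL-Library.FuncSet" "HOL-Library.Equipollence"
begin

section \<open>Categories\<close>

record ('o, 'm) cat =
  Ob :: "'o set"
  Mor :: "'m set"
  Dom :: "'m \<Rightarrow> 'o"
  Cod :: "'m \<Rightarrow> 'o"
  Id :: "'o \<Rightarrow> 'm"
  Comp :: "'m \<Rightarrow> 'm \<Rightarrow> 'm" (infixl "\<cdot>\<index>" 70)

definition hom :: "('o, 'm) cat \<Rightarrow> 'o \<Rightarrow> 'o \<Rightarrow> 'm set" where
  "hom C X Y = {f \<in> Mor C. Dom C f = X \<and> Cod C f = Y}"

definition category :: "('o, 'm) cat \<Rightarrow> bool" where
  "category C \<longleftrightarrow>
     (\<forall>f \<in> Mor C. Dom C f \<in> Ob C \<and> Cod C f \<in> Ob C) \<and>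
     (\<forall>X \<in> Ob C. Id C X \<in> hom C X X) \<and>
     (\<forall>f \<in> Mor C. \<forall>g \<in> Mor C. Dom C g = Cod C f \<longrightarrow> g \<cdot>\<^bsub>C\<^esub> f \<in> hom C (Dom C f) (Cod C g)) \<and>
     (\<forall>f \<in> Mor C. f \<cdot>\<^bsub>C\<^esub> Id C (Dom C f) = f \<and> Id C (Cod C f) \<cdot>\<^bsub>C\<^esub> f = f) \<and>
     (\<forall>f \<in> Mor C. \<forall>g \<in> Mor C. \<forall>h \<in> Mor C. Dom C g = Cod C f \<longrightarrow> Dom C h = Cod C g \<longrightarrow>
        (h \<cdot>\<^bsub>C\<^esub> g) \<cdot>\<^bsub>C\<^esub> f = h \<cdot>\<^bsub>C\<^esub> (g \<cdot>\<^bsub>C\<^esub> f))"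

definition iso :: "('o, 'm) cat \<Rightarrow> 'm \<Rightarrow> bool" where
  "iso C f \<longleftrightarrow> f \<in> Mor C \<and>
     (\<exists>g \<in> hom C (Cod C f) (Dom C f).
        g \<cdot>\<^bsub>C\<^esub> f = Id C (Dom C f) \<and> f \<cdot>\<^bsub>C\<^esub> g = Id C (Cod C f))"

text \<open>The square \<open>f p = g q\<close> is a pullback; \<open>q\<close> is the pullback of \<open>f\<close> along \<open>g\<close>.\<close>

definition is_pullback :: "('o, 'm) cat \<Rightarrow> 'm \<Rightarrow> 'm \<Rightarrow> 'm \<Rightarrow> 'm \<Rightarrow> bool" where
  "is_pullback C f g p q \<longleftrightarrow>
     f \<in> Mor C \<and> g \<in> Mor C \<and> Cod C f = Cod C g \<and>
     p \<in> hom C (Dom C p) (Dom C f) \<and> q \<in> hom C (Dom C p) (Dom C g) \<and>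
     f \<cdot>\<^bsub>C\<^esub> p = g \<cdot>\<^bsub>C\<^esub> q \<and>
     (\<forall>W \<in> Ob C. \<forall>a \<in> hom C W (Dom C f). \<forall>b \<in> hom C W (Dom C g).
        f \<cdot>\<^bsub>C\<^esub> a = g \<cdot>\<^bsub>C\<^esub> b \<longrightarrow>
        (\<exists>!u. u \<in> hom C W (Dom C p) \<and> p \<cdot>\<^bsub>C\<^esub> u = a \<and> q \<cdot>\<^bsub>C\<^esub> u = b))"

definition has_pullbacks :: "('o, 'm) cat \<Rightarrow> bool" where
  "has_pullbacks C \<longleftrightarrow>
     (\<forall>f \<in> Mor C. \<forall>g \<in> Mor C. Cod C f = Cod C g \<longrightarrow> (\<exists>p q. is_pullback C f g p q))"

text \<open>A functor from \<open>D\<close> to \<open>C\<close> is given by its actions \<open>Fo\<close> on objects and \<open>Fm\<close> on morphisms.\<close>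

definition is_cocone ::
  "('d, 'e) cat \<Rightarrow> ('o, 'm) cat \<Rightarrow> ('d \<Rightarrow> 'o) \<Rightarrow> ('e \<Rightarrow> 'm) \<Rightarrow> 'o \<Rightarrow> ('d \<Rightarrow> 'm) \<Rightarrow> bool" where
  "is_cocone D C Fo Fm L c \<longleftrightarrow>
     L \<in> Ob C \<and> (\<forall>d \<in> Ob D. c d \<in> hom C (Fo d) L) \<and>
     (\<forall>m \<in> Mor D. c (Cod D m) \<cdot>\<^bsub>C\<^esub> Fm m = c (Dom D m))"

definition is_colimit ::
  "('d, 'e) cat \<Rightarrow> ('o, 'm) cat \<Rightarrow> ('d \<Rightarrow> 'o) \<Rightarrow> ('e \<Rightarrow> 'm) \<Rightarrow> 'o \<Rightarrow> ('d \<Rightarrow> 'm) \<Rightarrow> bool" where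
  "is_colimit D C Fo Fm L c \<longleftrightarrow>
     is_cocone D C Fo Fm L c \<and>
     (\<forall>L' c'. is_cocone D C Fo Fm L' c' \<longrightarrow>
        (\<exists>!u. u \<in> hom C L L' \<and> (\<forall>d \<in> Ob D. u \<cdot>\<^bsub>C\<^esub> c d = c' d)))"

text \<open>A morphism of the overcategory from \<open>f\<close> to \<open>f'\<close> is a triple \<open>(f, g, f')\<close>
  with \<open>f' g = f\<close>.\<close>

definition overcategory :: "('o, 'm) cat \<Rightarrow> 'o \<Rightarrow> ('m, 'm \<times> 'm \<times> 'm) cat" where
  "overcategory C X =
     \<lparr> Ob = {f \<in> Mor C. Cod C f = X},
       Mor = {(f, g, f'). f \<in> Mor C \<and> Cod C f = X \<and> f' \<in> Mor C \<and> Cod C f' = X \<and>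
                g \<in> hom C (Dom C f) (Dom C f') \<and> f' \<cdot>\<^bsub>C\<^esub> g = f},
       Dom = (\<lambda>(f, g, f'). f),
       Cod = (\<lambda>(f, g, f'). f'),
       Id = (\<lambda>f. (f, Id C (Dom C f), f)),
       Comp = (\<lambda>(_, h, f'') (f, g, _). (f, h \<cdot>\<^bsub>C\<^esub> g, f'')) \<rparr>"

definition full_subcategory :: "('o, 'm) cat \<Rightarrow> 'o set \<Rightarrow> ('o, 'm) cat" where
  "full_subcategory D S =
     D \<lparr> Ob := S, Mor := {m \<in> Mor D. Dom D m \<in> S \<and> Cod D m \<in> S} \<rparr>"


section \<open>Sieves\<close>

definition sieve :: "('o, 'm) cat \<Rightarrow> 'o \<Rightarrow> 'm set \<Rightarrow> bool" where
  "sieve C X S \<longleftrightarrow>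
     S \<subseteq> {f \<in> Mor C. Cod C f = X} \<and>
     (\<forall>f \<in> S. \<forall>g \<in> Mor C. Cod C g = Dom C f \<longrightarrow> f \<cdot>\<^bsub>C\<^esub> g \<in> S)"

definition pullback_sieve :: "('o, 'm) cat \<Rightarrow> 'm \<Rightarrow> 'm set \<Rightarrow> 'm set" where
  "pullback_sieve C f S = {h \<in> Mor C. Cod C h = Dom C f \<and> f \<cdot>\<^bsub>C\<^esub> h \<in> S}"

definition generated_sieve :: "('o, 'm) cat \<Rightarrow> 'm set \<Rightarrow> 'm set" where
  "generated_sieve C F = {f \<cdot>\<^bsub>C\<^esub> g | f g. f \<in> F \<and> g \<in> Mor C \<and> Cod C g = Dom C f}"

text \<open>The functions \<open>Dom C\<close> and \<open>\<lambda>(f, g, f'). g\<close> are the forgetful functor on the sieve;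
  the morphism \<open>u\<close> is the canonical map from the colimit to \<open>X\<close>.\<close>

definition colim_sieve :: "('o, 'm) cat \<Rightarrow> 'o \<Rightarrow> 'm set \<Rightarrow> bool" where
  "colim_sieve C X S \<longleftrightarrow>
     sieve C X S \<and>
     (\<exists>L c u. is_colimit (full_subcategory (overcategory C X) S) C (Dom C) (\<lambda>(f, g, f'). g) L c \<and>
        u \<in> hom C L X \<and> (\<forall>f \<in> S. u \<cdot>\<^bsub>C\<^esub> c f = f) \<and> iso C u)"

definition universal_colim_sieve :: "('o, 'm) cat \<Rightarrow> 'o \<Rightarrow> 'm set \<Rightarrow> bool" where
  "universal_colim_sieve C X S \<longleftrightarrow>
     sieve C X S \<and>
     (\<forall>\<alpha> \<in> Mor C. Cod C \<alpha> = X \<longrightarrow> colim_sieve C (Dom C \<alpha>) (pullback_sieve C \<alpha> S))"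


section \<open>Grothendieck topologies, sheaves and the canonical topology\<close>

definition grothendieck_topology :: "('o, 'm) cat \<Rightarrow> ('o \<Rightarrow> 'm set set) \<Rightarrow> bool" where
  "grothendieck_topology C J \<longleftrightarrow>
     (\<forall>X \<in> Ob C. \<forall>S \<in> J X. sieve C X S) \<and>
     (\<forall>X \<in> Ob C. {f \<in> Mor C. Cod C f = X} \<in> J X) \<and>
     (\<forall>X \<in> Ob C. \<forall>S \<in> J X. \<forall>h \<in> Mor C. Cod C h = X \<longrightarrow> pullback_sieve C h S \<in> J (Dom C h)) \<and>
     (\<forall>X \<in> Ob C. \<forall>S \<in> J X. \<forall>R. sieve C X R \<longrightarrow>
        (\<forall>h \<in> S. pullback_sieve C h R \<in> J (Dom C h)) \<longrightarrow> R \<in> J X)"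

text \<open>A presheaf of sets is given by its sections \<open>Po\<close> and its restriction maps \<open>Pm\<close>.\<close>

definition presheaf ::
  "('o, 'm) cat \<Rightarrow> ('o \<Rightarrow> 'b set) \<Rightarrow> ('m \<Rightarrow> 'b \<Rightarrow> 'b) \<Rightarrow> bool" where
  "presheaf C Po Pm \<longleftrightarrow>
     (\<forall>f \<in> Mor C. Pm f \<in> Po (Cod C f) \<rightarrow> Po (Dom C f)) \<and>
     (\<forall>X \<in> Ob C. \<forall>a \<in> Po X. Pm (Id C X) a = a) \<and>
     (\<forall>f \<in> Mor C. \<forall>g \<in> Mor C. Dom C g = Cod C f \<longrightarrow>
        (\<forall>a \<in> Po (Cod C g). Pm (g \<cdot>\<^bsub>C\<^esub> f) a = Pm f (Pm g a)))"

definition matching_family ::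
  "('o, 'm) cat \<Rightarrow> ('o \<Rightarrow> 'b set) \<Rightarrow> ('m \<Rightarrow> 'b \<Rightarrow> 'b) \<Rightarrow> 'm set \<Rightarrow> ('m \<Rightarrow> 'b) \<Rightarrow> bool" where
  "matching_family C Po Pm S x \<longleftrightarrow>
     (\<forall>f \<in> S. x f \<in> Po (Dom C f)) \<and>
     (\<forall>f \<in> S. \<forall>g \<in> Mor C. Cod C g = Dom C f \<longrightarrow> x (f \<cdot>\<^bsub>C\<^esub> g) = Pm g (x f))"

definition sheaf ::
  "('o, 'm) cat \<Rightarrow> ('o \<Rightarrow> 'm set set) \<Rightarrow> ('o \<Rightarrow> 'b set) \<Rightarrow> ('m \<Rightarrow> 'b \<Rightarrow> 'b) \<Rightarrow> bool" where
  "sheaf C J Po Pm \<longleftrightarrow>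
     presheaf C Po Pm \<and>
     (\<forall>X \<in> Ob C. \<forall>S \<in> J X. \<forall>x. matching_family C Po Pm S x \<longrightarrow>
        (\<exists>!a. a \<in> Po X \<and> (\<forall>f \<in> S. Pm f a = x f)))"

definition representables_are_sheaves :: "('o, 'm) cat \<Rightarrow> ('o \<Rightarrow> 'm set set) \<Rightarrow> bool" where
  "representables_are_sheaves C J \<longleftrightarrow>
     (\<forall>Z \<in> Ob C. sheaf C J (\<lambda>A. hom C A Z) (\<lambda>f h. h \<cdot>\<^bsub>C\<^esub> f))"

definition is_canonical_topology :: "('o, 'm) cat \<Rightarrow> ('o \<Rightarrow> 'm set set) \<Rightarrow> bool" where
  "is_canonical_topology C J \<longleftrightarrow>
     grothendieck_topology C J \<and> representables_are_sheaves C J \<and>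
     (\<forall>J'. grothendieck_topology C J' \<and> representables_are_sheaves C J' \<longrightarrow>
        (\<forall>X \<in> Ob C. J' X \<subseteq> J X))"

text \<open>A basis in the sense of Mac Lane and Moerdijk. In the stability axiom, \<open>p\<close> and \<open>q\<close> are an
  arbitrary choice of a pullback square for each member of the family \<open>F\<close>.\<close>

definition grothendieck_basis :: "('o, 'm) cat \<Rightarrow> ('o \<Rightarrow> 'm set set) \<Rightarrow> bool" where
  "grothendieck_basis C K \<longleftrightarrow>
     has_pullbacks C \<and>
     (\<forall>X \<in> Ob C. \<forall>F \<in> K X. F \<subseteq> {f \<in> Mor C. Cod C f = X}) \<and>
     (\<forall>f. iso C f \<longrightarrow> {f} \<in> K (Cod C f)) \<and>
     (\<forall>X \<in> Ob C. \<forall>F \<in> K X. \<forall>g \<in> Mor C. Cod C g = X \<longrightarrow>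
        (\<forall>p q. (\<forall>f \<in> F. is_pullback C f g (p f) (q f)) \<longrightarrow> q ` F \<in> K (Dom C g))) \<and>
     (\<forall>X \<in> Ob C. \<forall>F \<in> K X. \<forall>G. (\<forall>f \<in> F. G f \<in> K (Dom C f)) \<longrightarrow>
        {f \<cdot>\<^bsub>C\<^esub> g | f g. f \<in> F \<and> g \<in> G f} \<in> K X)"

definition generated_topology ::
  "('o, 'm) cat \<Rightarrow> ('o \<Rightarrow> 'm set set) \<Rightarrow> 'o \<Rightarrow> 'm set set" where
  "generated_topology C K X = {S. sieve C X S \<and> (\<exists>F \<in> K X. F \<subseteq> S)}"


section \<open>The category of sets\<close>

text \<open>The sets of the category of sets are the members of a universe \<open>U\<close> of subsets of a type.
  The closure conditions hold for the small sets of every Grothendieck universe with an infinite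
  member, and also for the collection of all subsets of an arbitrary infinite type
  (see \<open>set_universe_UNIV\<close> below). Closure under power sets is deliberately not assumed:
  together with an infinite member it cannot be shown satisfiable in HOL.\<close>

definition set_universe :: "'u set set \<Rightarrow> bool" where
  "set_universe U \<longleftrightarrow>
     (\<exists>A \<in> U. infinite A) \<and>
     (\<forall>A \<in> U. \<forall>B. B \<lesssim> A \<longrightarrow> B \<in> U) \<and>
     (\<forall>I \<in> U. \<forall>A. (\<forall>i \<in> I. A i \<in> U) \<longrightarrow> (\<exists>C \<in> U. C \<approx> Sigma I A))"

text \<open>A map is a triple of its domain, its underlying function (undefined outside the domain,
  so that equality of maps is extensional) and its codomain.\<close>

type_synonym 'u map = "'u set \<times> ('u \<Rightarrow> 'u) \<times> 'u set"

definition app :: "'u map \<Rightarrow> 'u \<Rightarrow> 'u" where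
  "app m = fst (snd m)"

definition Sets :: "'u set set \<Rightarrow> ('u set, 'u map) cat" where
  "Sets U =
     \<lparr> Ob = U,
       Mor = {(A, f, B). A \<in> U \<and> B \<in> U \<and> f \<in> A \<rightarrow>\<^sub>E B},
       Dom = (\<lambda>m. fst m),
       Cod = (\<lambda>m. snd (snd m)),
       Id = (\<lambda>A. (A, (\<lambda>x\<in>A. x), A)),
       Comp = (\<lambda>n m. (fst m, compose (fst m) (app n) (app m), snd (snd n))) \<rparr>"

text \<open>The coproduct of the domains of a family of maps \<open>f i\<close> with index set \<open>I\<close> is the
  disjoint union.\<close>

definition coproduct_dom :: "'u set \<Rightarrow> ('u \<Rightarrow> 'u map) \<Rightarrow> ('u \<times> 'u) set" where
  "coproduct_dom I f = (SIGMA i:I. fst (f i))"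

definition induced_map :: "('u \<Rightarrow> 'u map) \<Rightarrow> 'u \<times> 'u \<Rightarrow> 'u" where
  "induced_map f = (\<lambda>(i, a). app (f i) a)"

definition map_family :: "'u set set \<Rightarrow> 'u set \<Rightarrow> 'u set \<Rightarrow> ('u \<Rightarrow> 'u map) \<Rightarrow> bool" where
  "map_family U X I f \<longleftrightarrow>
     I \<in> U \<and> (\<forall>i \<in> I. f i \<in> Mor (Sets U) \<and> Cod (Sets U) (f i) = X)"

definition surjective_families :: "'u set set \<Rightarrow> 'u set \<Rightarrow> 'u map set set" where
  "surjective_families U X =
     {f ` I | I f. map_family U X I f \<and> induced_map f ` coproduct_dom I f = X}"


section \<open>Consistency checks\<close>

lemma category_Sets: "category (Sets U)"
proof -
  have e: "compose A f (\<lambda>x\<in>A. x) = f" "compose A (\<lambda>x\<in>B. x) f = f" if "f \<in> A \<rightarrow>\<^sub>E B"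
    for A B and f :: "'a \<Rightarrow> 'a"
    using that by (auto simp: compose_def fun_eq_iff PiE_iff extensional_def Pi_iff)
  have a: "compose A (compose B h g) f = compose A h (compose A g f)" if "f \<in> A \<rightarrow>\<^sub>E B"
    for A B and f g h :: "'a \<Rightarrow> 'a"
    using that by (auto simp: compose_def fun_eq_iff PiE_iff)
  have c: "compose A g f \<in> A \<rightarrow>\<^sub>E D" if "f \<in> A \<rightarrow>\<^sub>E B" "g \<in> B \<rightarrow>\<^sub>E D" for A B D and f g :: "'a \<Rightarrow> 'a"
    using that by (auto simp: compose_def PiE_iff)
  show ?thesis
    unfolding category_def
  proof (intro conjI ballI impI)
  qed (auto simp: hom_def Sets_def app_def e a del: PiE_I intro: c)
qed

lemma category_overcategory:
  assumes "category C"
  shows "category (overcategory C X)"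
proof -
  have i: "Id C A \<in> hom C A A" if "A \<in> Ob C" for A
    using assms that unfolding category_def by blast
  have d: "Dom C f \<in> Ob C" if "f \<in> Mor C" for f
    using assms that unfolding category_def by blast
  have u: "f \<cdot>\<^bsub>C\<^esub> Id C (Dom C f) = f" "Id C (Cod C f) \<cdot>\<^bsub>C\<^esub> f = f" if "f \<in> Mor C" for f
    using assms that unfolding category_def by blast+
  have c: "g \<cdot>\<^bsub>C\<^esub> f \<in> Mor C" "Dom C (g \<cdot>\<^bsub>C\<^esub> f) = Dom C f" "Cod C (g \<cdot>\<^bsub>C\<^esub> f) = Cod C g"
    if "f \<in> Mor C" "g \<in> Mor C" "Dom C g = Cod C f" for f g
    using assms that unfolding category_def hom_def by blast+
  have a: "(h \<cdot>\<^bsub>C\<^esub> g) \<cdot>\<^bsub>C\<^esub> f = h \<cdot>\<^bsub>C\<^esub> (g \<cdot>\<^bsub>C\<^esub> f)"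
    if "f \<in> Mor C" "g \<in> Mor C" "h \<in> Mor C" "Dom C g = Cod C f" "Dom C h = Cod C g" for f g h
    using assms that unfolding category_def by blast
  have i': "Id C (Dom C f) \<in> Mor C" "Dom C (Id C (Dom C f)) = Dom C f"
    "Cod C (Id C (Dom C f)) = Dom C f" if "f \<in> Mor C" for f
    using i[OF d[OF that]] unfolding hom_def by blast+
  let ?D = "overcategory C X"
  have m: "m \<in> Mor ?D \<longleftrightarrow> (\<exists>f g f'. m = (f, g, f') \<and> f \<in> Mor C \<and> Cod C f = X \<and>
      f' \<in> Mor C \<and> Cod C f' = X \<and> g \<in> Mor C \<and> Dom C g = Dom C f \<and> Cod C g = Dom C f' \<and>
      f' \<cdot>\<^bsub>C\<^esub> g = f)" for m
    unfolding overcategory_def hom_def by auto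
  have s: "Dom ?D (f, g, f') = f" "Cod ?D (f, g, f') = f'" "Id ?D f = (f, Id C (Dom C f), f)"
    "(k', h, f'') \<cdot>\<^bsub>?D\<^esub> (f, g, k) = (f, h \<cdot>\<^bsub>C\<^esub> g, f'')" for f g f' k k' h f''
    unfolding overcategory_def by simp_all
  have o: "f \<in> Ob ?D \<longleftrightarrow> f \<in> Mor C \<and> Cod C f = X" for f
    unfolding overcategory_def by simp
  show ?thesis
    unfolding category_def
  proof (intro conjI ballI impI)
    fix m n assume mn: "m \<in> Mor ?D" "n \<in> Mor ?D" "Dom ?D n = Cod ?D m"
    then obtain f g f' h f'' where *: "m = (f, g, f')" "n = (f', h, f'')"
      "f \<in> Mor C" "Cod C f = X" "f'' \<in> Mor C" "Cod C f'' = X"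
      "g \<in> Mor C" "Dom C g = Dom C f" "Cod C g = Dom C f'" "f' \<cdot>\<^bsub>C\<^esub> g = f"
      "h \<in> Mor C" "Dom C h = Dom C f'" "Cod C h = Dom C f''" "f'' \<cdot>\<^bsub>C\<^esub> h = f'"
      unfolding m by (elim exE conjE) (simp add: s)
    have "f'' \<cdot>\<^bsub>C\<^esub> (h \<cdot>\<^bsub>C\<^esub> g) = f"
      using a[of g h f''] * by simp
    with * show "n \<cdot>\<^bsub>?D\<^esub> m \<in> hom ?D (Dom ?D m) (Cod ?D n)"
      unfolding hom_def by (simp add: m s c)
  next
    fix m n k assume mnk: "m \<in> Mor ?D" "n \<in> Mor ?D" "k \<in> Mor ?D"
      "Dom ?D n = Cod ?D m" "Dom ?D k = Cod ?D n"
    then show "(k \<cdot>\<^bsub>?D\<^esub> n) \<cdot>\<^bsub>?D\<^esub> m = k \<cdot>\<^bsub>?D\<^esub> (n \<cdot>\<^bsub>?D\<^esub> m)"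
      unfolding m by (elim exE conjE) (simp add: s a)
  next
    fix m assume "m \<in> Mor ?D"
    then obtain f g f' where *: "m = (f, g, f')" "g \<in> Mor C" "Dom C g = Dom C f" "Cod C g = Dom C f'"
      unfolding m by blast
    show "m \<cdot>\<^bsub>?D\<^esub> Id ?D (Dom ?D m) = m" "Id ?D (Cod ?D m) \<cdot>\<^bsub>?D\<^esub> m = m"
      using u[OF *(2)] * by (simp_all add: s)
  next
    fix f assume "f \<in> Ob ?D"
    then show "Id ?D f \<in> hom ?D f f"
      unfolding hom_def by (simp add: o m s i' u)
  next
    fix m assume "m \<in> Mor ?D"
    then show "Dom ?D m \<in> Ob ?D" "Cod ?D m \<in> Ob ?D"
      unfolding m by (elim exE conjE; simp add: o s)+
  qed
qed

lemma set_universe_UNIV: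
  assumes "infinite (UNIV :: 'u set)"
  shows "set_universe (UNIV :: 'u set set)"
proof -
  have "\<exists>C :: 'u set. C \<approx> Sigma I A" for I :: "'u set" and A :: "'u \<Rightarrow> 'u set"
  proof -
    have "(UNIV :: ('u \<times> 'u) set) \<approx> (UNIV :: 'u set)"
      using card_of_Times_same_infinite[OF assms]
      by (simp add: card_of_ordIso eqpoll_def flip: UNIV_Times_UNIV)
    then have "Sigma I A \<lesssim> (UNIV :: 'u set)"
      by (meson eqpoll_imp_lepoll lepoll_trans subset_UNIV subset_imp_lepoll)
    then obtain h :: "'u \<times> 'u \<Rightarrow> 'u" where "inj_on h (Sigma I A)" unfolding lepoll_def by auto
    then have "h ` Sigma I A \<approx> Sigma I A"
      by (simp add: inj_on_image_eqpoll_self)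
    then show ?thesis by blast
  qed
  then show ?thesis using assms unfolding set_universe_def by auto
qed

end

theory Submission
  imports Defs
begin

text \<open>All the notions of the theorem reduce to one elementary condition on a sieve \<open>S\<close> on a set
  \<open>X\<close>: every element of \<open>X\<close> is a value of some member of \<open>S\<close>.

  In any category, a cocone under the forgetful functor of \<open>S\<close> with vertex \<open>Z\<close> is precisely a
  matching family for the presheaf represented by \<open>Z\<close>. Hence \<open>S\<close> is a colim sieve if and only if
  each such family has a unique amalgamation (\<open>colim_sieve_iff_unique_amalgamation\<close>), and all
  representable presheaves are sheaves for a topology if and only if all its covering sieves have
  this property (\<open>representables_are_sheaves_iff\<close>).

  For sets, unique amalgamation is equivalent to joint surjectivity. A matching family is
  determined by its values at points, which are members of \<open>S\<close> if \<open>S\<close> is jointly surjective, and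
  these values assemble into a map on \<open>X\<close> (\<open>unique_amalgamation_if_jointly_onto\<close>). Conversely,
  a constant map from \<open>X\<close> to a set with two elements can be altered at the elements not reached by
  \<open>S\<close> without any change on \<open>S\<close>, so that uniqueness leaves no such elements
  (\<open>jointly_onto_if_unique_amalgamation\<close>).

  The sieves generated by the basis are also the jointly surjective ones: out of such a sieve,
  the points of \<open>X\<close> form a family indexed by \<open>X\<close> itself (\<open>generated_topology_iff\<close>). They thus form
  the largest topology with representable sheaves. Since joint surjectivity is stable under
  pullback, each colim sieve is universal. The axioms of a basis are checked on elements; the
  universe supplies the pullbacks and the index sets of composite families through its closure
  under disjoint unions.\<close>

section \<open>Colim sieves and unique amalgamation\<close>

definition unique_amalgamation :: "('o, 'm) cat \<Rightarrow> 'o \<Rightarrow> 'm set \<Rightarrow> bool" where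
  "unique_amalgamation C X S \<longleftrightarrow>
     (\<forall>Z \<in> Ob C. \<forall>x. matching_family C (\<lambda>A. hom C A Z) (\<lambda>f h. h \<cdot>\<^bsub>C\<^esub> f) S x \<longrightarrow>
        (\<exists>!a. a \<in> hom C X Z \<and> (\<forall>f \<in> S. a \<cdot>\<^bsub>C\<^esub> f = x f)))"

lemma category_compD:
  assumes "category C" "f \<in> hom C A B" "g \<in> hom C B D"
  shows "g \<cdot>\<^bsub>C\<^esub> f \<in> hom C A D"
  using assms unfolding category_def hom_def by simp

lemma category_assocD:
  assumes "category C" "f \<in> hom C A B" "g \<in> hom C B D" "h \<in> hom C D E"
  shows "(h \<cdot>\<^bsub>C\<^esub> g) \<cdot>\<^bsub>C\<^esub> f = h \<cdot>\<^bsub>C\<^esub> (g \<cdot>\<^bsub>C\<^esub> f)"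
  using assms unfolding category_def hom_def by simp

lemma category_idD:
  assumes "category C" "f \<in> hom C A B"
  shows "f \<cdot>\<^bsub>C\<^esub> Id C A = f" "Id C B \<cdot>\<^bsub>C\<^esub> f = f"
  using assms unfolding category_def hom_def by auto

lemma category_id_hom:
  assumes "category C" "A \<in> Ob C"
  shows "Id C A \<in> hom C A A"
  using assms unfolding category_def by blast

lemma is_pullback_lift:
  assumes "is_pullback C f g p q" "W \<in> Ob C" "a \<in> hom C W (Dom C f)" "b \<in> hom C W (Dom C g)"
    "f \<cdot>\<^bsub>C\<^esub> a = g \<cdot>\<^bsub>C\<^esub> b"
  obtains u where "u \<in> hom C W (Dom C p)" "p \<cdot>\<^bsub>C\<^esub> u = a" "q \<cdot>\<^bsub>C\<^esub> u = b"
proof -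
  from assms(1) have "\<exists>!u. u \<in> hom C W (Dom C p) \<and> p \<cdot>\<^bsub>C\<^esub> u = a \<and> q \<cdot>\<^bsub>C\<^esub> u = b"
    unfolding is_pullback_def using assms(2-5) by blast
  then show thesis using that by blast
qed

lemma presheaf_representable:
  assumes "category C"
  shows "presheaf C (\<lambda>A. hom C A Z) (\<lambda>f h. h \<cdot>\<^bsub>C\<^esub> f)"
proof -
  have 1: "(a \<cdot>\<^bsub>C\<^esub> g) \<cdot>\<^bsub>C\<^esub> f = a \<cdot>\<^bsub>C\<^esub> (g \<cdot>\<^bsub>C\<^esub> f)"
    if "f \<in> Mor C" "g \<in> Mor C" "Dom C g = Cod C f" "a \<in> hom C (Cod C g) Z" for f g a
    using that by (intro category_assocD[OF assms, of f "Dom C f" "Cod C f" g "Cod C g" a Z])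
      (auto simp: hom_def)
  have 2: "h \<cdot>\<^bsub>C\<^esub> f \<in> hom C (Dom C f) Z" if "f \<in> Mor C" "h \<in> hom C (Cod C f) Z" for f h
    using that by (intro category_compD[OF assms, of f _ "Cod C f" h Z]) (auto simp: hom_def)
  show ?thesis
    unfolding presheaf_def using 1 2 category_idD(1)[OF assms] by (simp add: Pi_def)
qed

lemma representables_are_sheaves_iff:
  assumes "category C"
  shows "representables_are_sheaves C J \<longleftrightarrow> (\<forall>X \<in> Ob C. \<forall>S \<in> J X. unique_amalgamation C X S)"
  unfolding representables_are_sheaves_def sheaf_def unique_amalgamation_def
  using presheaf_representable[OF assms] by blast

text \<open>A morphism of the sieve, seen as a category, from \<open>f \<cdot> g\<close> to \<open>f\<close> is the same
  as a factorization of the former through the latter. So compatibility of a cocone with these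
  morphisms is the matching condition.\<close>

lemma cocone_on_sieve_iff_matching_family:
  assumes "category C" "sieve C X S"
  shows "is_cocone (full_subcategory (overcategory C X) S) C (Dom C) (\<lambda>(f, g, f'). g) Z c \<longleftrightarrow>
    Z \<in> Ob C \<and> matching_family C (\<lambda>A. hom C A Z) (\<lambda>f h. h \<cdot>\<^bsub>C\<^esub> f) S c"
proof -
  have S: "f \<in> Mor C" "Cod C f = X" if "f \<in> S" for f
    using assms(2) that unfolding sieve_def by auto
  have closed: "f \<cdot>\<^bsub>C\<^esub> g \<in> S" if "f \<in> S" "g \<in> Mor C" "Cod C g = Dom C f" for f g
    using assms(2) that unfolding sieve_def by auto
  have D: "Dom C (f \<cdot>\<^bsub>C\<^esub> g) = Dom C g" if "f \<in> S" "g \<in> Mor C" "Cod C g = Dom C f" for f g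
    using category_compD[OF assms(1), of g "Dom C g" "Cod C g" f X] that S[OF that(1)]
    by (auto simp: hom_def)
  have "(\<forall>m \<in> Mor (full_subcategory (overcategory C X) S).
           c (Cod (full_subcategory (overcategory C X) S) m) \<cdot>\<^bsub>C\<^esub> (\<lambda>(f, g, f'). g) m =
           c (Dom (full_subcategory (overcategory C X) S) m)) \<longleftrightarrow>
        (\<forall>f \<in> S. \<forall>g \<in> Mor C. Cod C g = Dom C f \<longrightarrow> c (f \<cdot>\<^bsub>C\<^esub> g) = c f \<cdot>\<^bsub>C\<^esub> g)"
    (is "?L \<longleftrightarrow> ?R")
  proof
    assume L: ?L
    show ?R
    proof (intro ballI impI)
      fix f g assume fg: "f \<in> S" "g \<in> Mor C" "Cod C g = Dom C f"
      have "(f \<cdot>\<^bsub>C\<^esub> g, g, f) \<in> Mor (full_subcategory (overcategory C X) S)"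
        using fg S closed D by (simp add: full_subcategory_def overcategory_def hom_def)
      from L[rule_format, OF this] show "c (f \<cdot>\<^bsub>C\<^esub> g) = c f \<cdot>\<^bsub>C\<^esub> g"
        by (simp add: full_subcategory_def overcategory_def)
    qed
  next
    assume ?R
    then show ?L by (auto simp: full_subcategory_def overcategory_def hom_def)
  qed
  then show ?thesis
    unfolding is_cocone_def matching_family_def
    by (auto simp: full_subcategory_def)
qed

text \<open>If \<open>u\<close> is the canonical isomorphism from a colimit to \<open>X\<close>, maps out of the colimit become maps out
  of \<open>X\<close> by composition with its inverse, and the colimit property becomes unique amalgamation.
  Conversely, unique amalgamation says that \<open>X\<close> itself is a colimit, the cocone being given by
  the members of the sieve, with the identity as canonical map.\<close>

lemma colim_sieve_iff_unique_amalgamation: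
  assumes C: "category C" and X: "X \<in> Ob C"
  shows "colim_sieve C X S \<longleftrightarrow> sieve C X S \<and> unique_amalgamation C X S"
proof (cases "sieve C X S")
  case False
  then show ?thesis unfolding colim_sieve_def by simp
next
  case S: True
  note cocone = cocone_on_sieve_iff_matching_family[OF C S]
  have Ob: "Ob (full_subcategory (overcategory C X) S) = S"
    by (simp add: full_subcategory_def)
  have SX: "f \<in> hom C (Dom C f) X" if "f \<in> S" for f
    using S that unfolding sieve_def hom_def by auto
  show ?thesis
  proof
    assume "colim_sieve C X S"
    then obtain L c u where
      colim: "is_colimit (full_subcategory (overcategory C X) S) C (Dom C) (\<lambda>(f, g, f'). g) L c"
      and u: "u \<in> hom C L X" "\<And>f. f \<in> S \<Longrightarrow> u \<cdot>\<^bsub>C\<^esub> c f = f" and "iso C u"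
      unfolding colim_sieve_def by blast
    then obtain v where v: "v \<in> hom C X L" "v \<cdot>\<^bsub>C\<^esub> u = Id C L" "u \<cdot>\<^bsub>C\<^esub> v = Id C X"
      unfolding iso_def hom_def by auto
    have c: "c f \<in> hom C (Dom C f) L" if "f \<in> S" for f
      using colim that unfolding is_colimit_def is_cocone_def Ob by blast
    \<comment> \<open>The inverse of \<open>u\<close> identifies the members of the sieve with the legs of the colimit.\<close>
    have vf: "v \<cdot>\<^bsub>C\<^esub> f = c f" if "f \<in> S" for f
      using category_assocD[OF C c[OF that] u(1) v(1)] category_idD(2)[OF C c[OF that]] u(2)[OF that]
        v(2) by simp
    have "\<exists>!a. a \<in> hom C X Z \<and> (\<forall>f \<in> S. a \<cdot>\<^bsub>C\<^esub> f = x f)"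
      if Z: "Z \<in> Ob C"
        and x: "matching_family C (\<lambda>A. hom C A Z) (\<lambda>f h. h \<cdot>\<^bsub>C\<^esub> f) S x" for Z x
    proof -
      have "\<exists>!w. w \<in> hom C L Z \<and> (\<forall>f \<in> S. w \<cdot>\<^bsub>C\<^esub> c f = x f)"
        using colim Z x cocone unfolding is_colimit_def Ob by blast
      then obtain w where w: "w \<in> hom C L Z" "\<And>f. f \<in> S \<Longrightarrow> w \<cdot>\<^bsub>C\<^esub> c f = x f"
        and unique: "\<And>w'. w' \<in> hom C L Z \<Longrightarrow> (\<forall>f \<in> S. w' \<cdot>\<^bsub>C\<^esub> c f = x f) \<Longrightarrow> w' = w"
        by blast
      show ?thesis
      proof (rule ex1I[of _ "w \<cdot>\<^bsub>C\<^esub> v"])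
        show "w \<cdot>\<^bsub>C\<^esub> v \<in> hom C X Z \<and> (\<forall>f \<in> S. (w \<cdot>\<^bsub>C\<^esub> v) \<cdot>\<^bsub>C\<^esub> f = x f)"
          using category_compD[OF C v(1) w(1)] category_assocD[OF C SX v(1) w(1)] vf w(2) by simp
      next
        fix a assume a: "a \<in> hom C X Z \<and> (\<forall>f \<in> S. a \<cdot>\<^bsub>C\<^esub> f = x f)"
        then have "a \<cdot>\<^bsub>C\<^esub> u = w"
          using unique[of "a \<cdot>\<^bsub>C\<^esub> u"] category_compD[OF C u(1), of a Z] u(2)
            category_assocD[OF C c u(1), of _ a Z] by simp
        then show "a = w \<cdot>\<^bsub>C\<^esub> v"
          using category_assocD[OF C v(1) u(1), of a Z] category_idD(1)[OF C, of a X Z] a v(3) by simp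
      qed
    qed
    then show "sieve C X S \<and> unique_amalgamation C X S"
      using S unfolding unique_amalgamation_def by blast
  next
    assume "sieve C X S \<and> unique_amalgamation C X S"
    then have amalg: "unique_amalgamation C X S" ..
    have idX: "Id C X \<in> hom C X X" by (rule category_id_hom[OF C X])
    have "matching_family C (\<lambda>A. hom C A X) (\<lambda>f h. h \<cdot>\<^bsub>C\<^esub> f) S (\<lambda>f. f)"
      unfolding matching_family_def using SX by simp
    then have "is_colimit (full_subcategory (overcategory C X) S) C (Dom C) (\<lambda>(f, g, f'). g)
        X (\<lambda>f. f)"
      using amalg X unfolding is_colimit_def cocone Ob unique_amalgamation_def by blast
    moreover have "\<forall>f \<in> S. Id C X \<cdot>\<^bsub>C\<^esub> f = f"
      using category_idD(2)[OF C SX] by blast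
    moreover have "iso C (Id C X)"
      using idX category_idD(1)[OF C idX] unfolding iso_def hom_def by auto
    ultimately show "colim_sieve C X S"
      using S idX unfolding colim_sieve_def by blast
  qed
qed


section \<open>Maps of sets and their points\<close>

definition map_of_fun :: "'u set \<Rightarrow> ('u \<Rightarrow> 'u) \<Rightarrow> 'u set \<Rightarrow> 'u map" where
  "map_of_fun A h B = (A, restrict h A, B)"

text \<open>All points share one domain, so that two maps with a common value have the same composite
  with suitable points. The element \<open>undefined\<close> only names an arbitrary member of the type.\<close>

definition point :: "'u set \<Rightarrow> 'u \<Rightarrow> 'u map" where
  "point B b = map_of_fun {undefined} (\<lambda>_. b) B"

definition jointly_onto :: "'u set \<Rightarrow> 'u map set \<Rightarrow> bool" where
  "jointly_onto X F \<longleftrightarrow> (\<forall>x \<in> X. \<exists>f \<in> F. \<exists>a \<in> fst f. app f a = x)"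

lemma Ob_Sets [simp]: "Ob (Sets U) = U"
  and Dom_Sets [simp]: "Dom (Sets U) f = fst f"
  and Cod_Sets [simp]: "Cod (Sets U) f = snd (snd f)"
  by (simp_all add: Sets_def)

lemma Mor_Sets_iff: "f \<in> Mor (Sets U) \<longleftrightarrow> f \<in> hom (Sets U) (fst f) (snd (snd f))"
  by (simp add: hom_def)

lemma hom_Sets_iff:
  "f \<in> hom (Sets U) A B \<longleftrightarrow> A \<in> U \<and> B \<in> U \<and> fst f = A \<and> snd (snd f) = B \<and> app f \<in> A \<rightarrow>\<^sub>E B"
  by (cases f) (auto simp: hom_def Sets_def app_def)

lemma hom_SetsD:
  assumes "f \<in> hom (Sets U) A B"
  shows "A \<in> U" "B \<in> U" "fst f = A" "snd (snd f) = B" "\<And>a. a \<in> A \<Longrightarrow> app f a \<in> B"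
  using assms by (auto simp: hom_Sets_iff)

lemma comp_Sets_simps:
  "fst (g \<cdot>\<^bsub>Sets U\<^esub> f) = fst f"
  "snd (snd (g \<cdot>\<^bsub>Sets U\<^esub> f)) = snd (snd g)"
  "a \<in> fst f \<Longrightarrow> app (g \<cdot>\<^bsub>Sets U\<^esub> f) a = app g (app f a)"
  by (simp_all add: Sets_def app_def compose_def)

lemma map_eqI:
  assumes "f \<in> hom (Sets U) A B" "g \<in> hom (Sets U) A B" "\<And>a. a \<in> A \<Longrightarrow> app f a = app g a"
  shows "f = g"
proof -
  have "app f = app g"
    using assms by (intro extensionalityI[of _ A]) (auto simp: hom_Sets_iff PiE_iff)
  then show ?thesis
    using assms(1,2) by (cases f; cases g) (auto simp: hom_Sets_iff app_def)
qed

lemma hom_map_of_fun: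
  assumes "A \<in> U" "B \<in> U" "\<And>a. a \<in> A \<Longrightarrow> h a \<in> B"
  shows "map_of_fun A h B \<in> hom (Sets U) A B"
  using assms by (auto simp: hom_Sets_iff map_of_fun_def app_def)

lemma app_map_of_fun: "a \<in> A \<Longrightarrow> app (map_of_fun A h B) a = h a"
  by (simp add: map_of_fun_def app_def)

lemma fst_point [simp]: "fst (point B b) = {undefined}"
  and app_point [simp]: "app (point B b) undefined = b"
  by (simp_all add: point_def map_of_fun_def app_def)

lemma jointly_onto_mono:
  assumes "jointly_onto X F" "F \<subseteq> G"
  shows "jointly_onto X G"
  using assms unfolding jointly_onto_def by blast


section \<open>Sieves over a universe of sets\<close>

locale universe =
  fixes U :: "'u set set"
  assumes set_universe: "set_universe U"
begin

abbreviation comp :: "'u map \<Rightarrow> 'u map \<Rightarrow> 'u map" (infixl "\<odot>" 70) where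
  "g \<odot> f \<equiv> g \<cdot>\<^bsub>Sets U\<^esub> f"

lemmas comp_hom = category_compD[OF category_Sets[of U]]

lemma lepoll_closed: "A \<in> U \<Longrightarrow> B \<lesssim> A \<Longrightarrow> B \<in> U"
  using set_universe unfolding set_universe_def by blast

text \<open>This makes the domain of points and a set of two truth values available in every universe.\<close>

lemma finite_in_universe:
  assumes "finite B" shows "B \<in> U"
proof -
  obtain A where "A \<in> U" "infinite A" using set_universe unfolding set_universe_def by blast
  then show ?thesis using lepoll_closed finite_lepoll_infinite assms by blast
qed

lemma Sigma_in_universe:
  assumes "I \<in> U" "\<And>i. i \<in> I \<Longrightarrow> A i \<in> U"
  obtains C h where "C \<in> U" "bij_betw h C (Sigma I A)"
proof -
  from assms have "\<exists>C \<in> U. C \<approx> Sigma I A"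
    using set_universe unfolding set_universe_def by simp
  then show thesis using that unfolding eqpoll_def by blast
qed

lemma point_hom: "B \<in> U \<Longrightarrow> b \<in> B \<Longrightarrow> point B b \<in> hom (Sets U) {undefined} B"
  unfolding point_def using finite_in_universe[of "{undefined}"] by (simp add: hom_map_of_fun)

lemma comp_point:
  assumes "f \<in> hom (Sets U) A B" "a \<in> A"
  shows "f \<odot> point A a = point B (app f a)"
proof (rule map_eqI)
  show "f \<odot> point A a \<in> hom (Sets U) {undefined} B"
    using comp_hom point_hom assms hom_SetsD by metis
  show "point B (app f a) \<in> hom (Sets U) {undefined} B"
    using point_hom assms hom_SetsD by metis
qed (simp add: comp_Sets_simps)

lemma sieve_homD: "sieve (Sets U) X S \<Longrightarrow> f \<in> S \<Longrightarrow> f \<in> hom (Sets U) (fst f) X"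
  unfolding sieve_def hom_def by auto

text \<open>Composing \<open>f\<close> with the point \<open>a\<close> of its domain gives the point \<open>f a\<close> of \<open>X\<close>.\<close>

lemma sieve_contains_points:
  assumes S: "sieve (Sets U) X S" and "f \<in> S" "a \<in> fst f"
  shows "point X (app f a) \<in> S"
proof -
  have f: "f \<in> hom (Sets U) (fst f) X" using sieve_homD[OF S] assms by blast
  then have "point (fst f) a \<in> hom (Sets U) {undefined} (fst f)"
    using point_hom assms hom_SetsD(1) by blast
  then have "f \<odot> point (fst f) a \<in> S"
    using S assms unfolding sieve_def hom_def by auto
  then show ?thesis using comp_point[OF f] assms by simp
qed

lemma jointly_onto_sieve_iff:
  assumes "sieve (Sets U) X S"
  shows "jointly_onto X S \<longleftrightarrow> (\<forall>x \<in> X. point X x \<in> S)"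
proof
  show "\<forall>x \<in> X. point X x \<in> S" if "jointly_onto X S"
  proof
    fix x assume "x \<in> X"
    then obtain f a where "f \<in> S" "a \<in> fst f" "app f a = x"
      using \<open>jointly_onto X S\<close> unfolding jointly_onto_def by blast
    then show "point X x \<in> S" using sieve_contains_points[OF assms] by blast
  qed
  show "jointly_onto X S" if points: "\<forall>x \<in> X. point X x \<in> S"
    unfolding jointly_onto_def
  proof
    fix x assume "x \<in> X"
    then have "point X x \<in> S" using points by blast
    moreover have "\<exists>a \<in> fst (point X x). app (point X x) a = x" by simp
    ultimately show "\<exists>f \<in> S. \<exists>a \<in> fst f. app f a = x" by blast
  qed
qed

text \<open>Both \<open>f\<close> and the members of the sieve that share its value at \<open>a\<close> restrict to the same point of
  \<open>X\<close>. The value of \<open>x f\<close> at \<open>a\<close> therefore depends on that point only, which is why the maps of a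
  matching family can be glued.\<close>

lemma matching_family_appD:
  assumes S: "sieve (Sets U) X S"
    and x: "matching_family (Sets U) (\<lambda>A. hom (Sets U) A Z) (\<lambda>f h. h \<odot> f) S x"
    and f: "f \<in> S" "a \<in> fst f"
  shows "app (x f) a = app (x (point X (app f a))) undefined"
proof -
  have fh: "f \<in> hom (Sets U) (fst f) X" using sieve_homD[OF S] f by blast
  then have p: "point (fst f) a \<in> hom (Sets U) {undefined} (fst f)"
    using point_hom f hom_SetsD(1) by blast
  have "x (f \<odot> point (fst f) a) = x f \<odot> point (fst f) a"
    using x f p unfolding matching_family_def hom_def by simp
  then show ?thesis
    using comp_point[OF fh f(2)] by (simp add: comp_Sets_simps)
qed

text \<open>The amalgamation sends \<open>b\<close> to the value of the matching family at the point \<open>b\<close>, a member of the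
  sieve. No other choice is possible, as an amalgamation is prescribed on these points.\<close>

lemma unique_amalgamation_if_jointly_onto:
  assumes X: "X \<in> U" and S: "sieve (Sets U) X S" and onto: "jointly_onto X S"
  shows "unique_amalgamation (Sets U) X S"
  unfolding unique_amalgamation_def
proof (intro ballI allI impI)
  fix Z x
  assume "Z \<in> Ob (Sets U)"
    and x: "matching_family (Sets U) (\<lambda>A. hom (Sets U) A Z) (\<lambda>f h. h \<odot> f) S x"
  then have Z: "Z \<in> U" by simp
  have pS: "point X b \<in> S" if "b \<in> X" for b
    using onto that jointly_onto_sieve_iff[OF S] by blast
  have xf: "x f \<in> hom (Sets U) (fst f) Z" if "f \<in> S" for f
    using x that unfolding matching_family_def by simp
  define a where "a = map_of_fun X (\<lambda>b. app (x (point X b)) undefined) Z"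
  have a: "a \<in> hom (Sets U) X Z"
    unfolding a_def using X Z xf[OF pS] by (intro hom_map_of_fun) (auto dest: hom_SetsD(5))
  have comp_S: "b \<odot> f \<in> hom (Sets U) (fst f) Z" if "f \<in> S" "b \<in> hom (Sets U) X Z" for f b
    using comp_hom sieve_homD[OF S] that by blast
  show "\<exists>!a. a \<in> hom (Sets U) X Z \<and> (\<forall>f \<in> S. a \<odot> f = x f)"
  proof (rule ex1I[of _ a], intro conjI ballI)
    show "a \<in> hom (Sets U) X Z" by fact
    fix f assume f: "f \<in> S"
    have "app (a \<odot> f) b = app (x f) b" if "b \<in> fst f" for b
      using that matching_family_appD[OF S x f that] hom_SetsD(5)[OF sieve_homD[OF S f] that]
      by (simp add: comp_Sets_simps a_def app_map_of_fun)
    then show "a \<odot> f = x f"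
      using map_eqI[OF comp_S[OF f a] xf[OF f]] by blast
  next
    fix b assume b: "b \<in> hom (Sets U) X Z \<and> (\<forall>f \<in> S. b \<odot> f = x f)"
    have "app b c = app a c" if "c \<in> X" for c
      using b pS[OF that] that comp_Sets_simps(3)[of undefined "point X c" U b]
      by (simp add: a_def app_map_of_fun)
    then show "b = a" using map_eqI[of b U X Z a] a b by simp
  qed
qed

text \<open>The constant function with value \<open>t\<close> and the function that has this value only on the union
  of the images agree after composition with each member of the sieve. Both amalgamate the same
  matching family, so they are equal, and the union is all of \<open>X\<close>.\<close>

lemma jointly_onto_if_unique_amalgamation:
  assumes X: "X \<in> U" and S: "sieve (Sets U) X S" and amalg: "unique_amalgamation (Sets U) X S"
  shows "jointly_onto X S"
proof -
  obtain A where "A \<in> U" "infinite A" using set_universe unfolding set_universe_def by blast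
  then obtain t where "infinite (A - {t})" by simp
  then obtain e where "e \<in> A - {t}" using infinite_imp_nonempty by blast
  then have te: "t \<noteq> e" by blast
  define Z where "Z = {t, e}"
  have Z: "Z \<in> U" unfolding Z_def by (rule finite_in_universe) simp
  define hit where "hit b \<longleftrightarrow> (\<exists>f \<in> S. \<exists>a \<in> fst f. app f a = b)" for b
  define v where "v = map_of_fun X (\<lambda>b. t) Z"
  define w where "w = map_of_fun X (\<lambda>b. if hit b then t else e) Z"
  have v: "v \<in> hom (Sets U) X Z" and w: "w \<in> hom (Sets U) X Z"
    unfolding v_def w_def using X Z by (auto intro!: hom_map_of_fun simp: Z_def)
  have match: "matching_family (Sets U) (\<lambda>A. hom (Sets U) A Z) (\<lambda>f h. h \<odot> f) S (\<lambda>f. v \<odot> f)"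
    unfolding matching_family_def
  proof (intro conjI ballI impI)
    show "v \<odot> f \<in> hom (Sets U) (Dom (Sets U) f) Z" if "f \<in> S" for f
      using comp_hom sieve_homD[OF S that] v by simp
    fix f g assume "f \<in> S" "g \<in> Mor (Sets U)" "Cod (Sets U) g = Dom (Sets U) f"
    then show "v \<odot> (f \<odot> g) = v \<odot> f \<odot> g"
      using category_assocD[OF category_Sets[of U] _ sieve_homD[OF S] v, of g "fst g" f]
      by (simp add: Mor_Sets_iff)
  qed
  have "w \<odot> f = v \<odot> f" if "f \<in> S" for f
  proof (rule map_eqI)
    have f: "f \<in> hom (Sets U) (fst f) X" using sieve_homD[OF S that] .
    show "w \<odot> f \<in> hom (Sets U) (fst f) Z" "v \<odot> f \<in> hom (Sets U) (fst f) Z"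
      using comp_hom f v w by blast+
    show "app (w \<odot> f) a = app (v \<odot> f) a" if "a \<in> fst f" for a
      using that \<open>f \<in> S\<close> hom_SetsD(5)[OF f that]
      by (auto simp: comp_Sets_simps v_def w_def app_map_of_fun hit_def)
  qed
  then have "w = v"
    using amalg match v w Z unfolding unique_amalgamation_def Ob_Sets by blast
  then have "hit b" if "b \<in> X" for b
    using te app_map_of_fun[OF that, of "\<lambda>b. if hit b then t else e" Z]
      app_map_of_fun[OF that, of "\<lambda>b. t" Z] unfolding v_def w_def
    by (simp split: if_splits)
  then show ?thesis unfolding jointly_onto_def hit_def by blast
qed

lemma colim_sieve_iff_jointly_onto:
  assumes "X \<in> U"
  shows "colim_sieve (Sets U) X S \<longleftrightarrow> sieve (Sets U) X S \<and> jointly_onto X S"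
  using colim_sieve_iff_unique_amalgamation[OF category_Sets, of X U S] assms
    unique_amalgamation_if_jointly_onto jointly_onto_if_unique_amalgamation by auto

lemma sieve_pullback:
  assumes "sieve (Sets U) X S" "h \<in> Mor (Sets U)" "snd (snd h) = X"
  shows "sieve (Sets U) (fst h) (pullback_sieve (Sets U) h S)"
  unfolding sieve_def
proof (intro conjI ballI impI)
  show "pullback_sieve (Sets U) h S \<subseteq> {f \<in> Mor (Sets U). Cod (Sets U) f = fst h}"
    by (auto simp: pullback_sieve_def)
  fix f g
  assume f: "f \<in> pullback_sieve (Sets U) h S" and g: "g \<in> Mor (Sets U)"
    "Cod (Sets U) g = Dom (Sets U) f"
  have fh: "f \<in> hom (Sets U) (fst f) (fst h)" "h \<odot> f \<in> S"
    using f by (auto simp: pullback_sieve_def hom_def)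
  have gh: "g \<in> hom (Sets U) (fst g) (fst f)" using g by (simp add: hom_def)
  have hh: "h \<in> hom (Sets U) (fst h) X" using assms by (simp add: hom_def)
  have "h \<odot> (f \<odot> g) = h \<odot> f \<odot> g"
    using category_assocD[OF category_Sets gh fh(1) hh] by simp
  also have "\<dots> \<in> S" using assms(1) fh(2) g unfolding sieve_def by (simp add: comp_Sets_simps)
  finally show "f \<odot> g \<in> pullback_sieve (Sets U) h S"
    using comp_hom[OF gh fh(1)] by (simp add: pullback_sieve_def hom_def)
qed

text \<open>The point \<open>y\<close> of the domain of \<open>h\<close> belongs to the pulled back sieve because \<open>h\<close> sends it to the
  point \<open>h y\<close> of \<open>X\<close>, which belongs to \<open>S\<close>.\<close>

lemma jointly_onto_pullback:
  assumes S: "sieve (Sets U) X S" and onto: "jointly_onto X S"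
    and h: "h \<in> Mor (Sets U)" "snd (snd h) = X"
  shows "jointly_onto (fst h) (pullback_sieve (Sets U) h S)"
proof -
  have hh: "h \<in> hom (Sets U) (fst h) X" using h by (simp add: hom_def)
  have "point (fst h) y \<in> pullback_sieve (Sets U) h S" if "y \<in> fst h" for y
  proof -
    have "point X (app h y) \<in> S"
      using onto jointly_onto_sieve_iff[OF S] hom_SetsD(5)[OF hh that] by blast
    then have "h \<odot> point (fst h) y \<in> S" using comp_point[OF hh that] by simp
    then show ?thesis
      using point_hom[OF hom_SetsD(1)[OF hh] that] by (simp add: pullback_sieve_def hom_def)
  qed
  then show ?thesis using jointly_onto_sieve_iff[OF sieve_pullback[OF S h]] by blast
qed

lemma universal_if_colim_sieve:
  assumes X: "X \<in> U" and "colim_sieve (Sets U) X S"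
  shows "universal_colim_sieve (Sets U) X S"
proof -
  have S: "sieve (Sets U) X S" "jointly_onto X S"
    using assms colim_sieve_iff_jointly_onto[OF X] by auto
  have "colim_sieve (Sets U) (fst h) (pullback_sieve (Sets U) h S)"
    if "h \<in> Mor (Sets U)" "snd (snd h) = X" for h
  proof -
    have "fst h \<in> U" using that(1) hom_SetsD(1) unfolding Mor_Sets_iff by blast
    then show ?thesis
      using colim_sieve_iff_jointly_onto sieve_pullback[OF S(1) that]
        jointly_onto_pullback[OF S that] by blast
  qed
  then show ?thesis unfolding universal_colim_sieve_def using S by simp
qed


section \<open>Jointly surjective families form a basis\<close>

lemma jointly_onto_image_iff:
  assumes "map_family U X I f"
  shows "induced_map f ` coproduct_dom I f = X \<longleftrightarrow> jointly_onto X (f ` I)"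
proof -
  have "app (f i) a \<in> X" if "i \<in> I" "a \<in> fst (f i)" for i a
    using assms that hom_SetsD(5)[of "f i" U "fst (f i)" X]
    unfolding map_family_def by (auto simp: hom_def)
  then have "induced_map f ` coproduct_dom I f \<subseteq> X"
    by (auto simp: induced_map_def coproduct_dom_def)
  then show ?thesis
    unfolding jointly_onto_def induced_map_def coproduct_dom_def by (force simp: image_iff)
qed

lemma surjective_familiesE:
  assumes "F \<in> surjective_families U X"
  obtains I f where "F = f ` I" "map_family U X I f" "jointly_onto X F"
  using assms jointly_onto_image_iff unfolding surjective_families_def by blast

lemma surjective_familiesI:
  assumes "I \<in> U" "\<And>i. i \<in> I \<Longrightarrow> f i \<in> Mor (Sets U) \<and> snd (snd (f i)) = X"
    "jointly_onto X (f ` I)"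
  shows "f ` I \<in> surjective_families U X"
proof -
  have "map_family U X I f" using assms unfolding map_family_def by simp
  with assms(3) jointly_onto_image_iff show ?thesis unfolding surjective_families_def by blast
qed

text \<open>A jointly surjective sieve may be too large to be indexed by a member of the universe, but its
  points already form a jointly surjective family, and they are indexed by \<open>X\<close>.\<close>

lemma generated_topology_iff:
  assumes X: "X \<in> U"
  shows "S \<in> generated_topology (Sets U) (surjective_families U) X \<longleftrightarrow>
    sieve (Sets U) X S \<and> jointly_onto X S"
proof
  assume "S \<in> generated_topology (Sets U) (surjective_families U) X"
  then show "sieve (Sets U) X S \<and> jointly_onto X S"
    unfolding generated_topology_def by (auto elim!: surjective_familiesE intro: jointly_onto_mono)
next
  assume S: "sieve (Sets U) X S \<and> jointly_onto X S"
  then have p: "point X x \<in> S" if "x \<in> X" for x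
    using that jointly_onto_sieve_iff by blast
  have "point X ` X \<in> surjective_families U X"
  proof (rule surjective_familiesI[OF X])
    show "point X x \<in> Mor (Sets U) \<and> snd (snd (point X x)) = X" if "x \<in> X" for x
      using point_hom[OF X that] by (simp add: hom_def)
    show "jointly_onto X (point X ` X)" unfolding jointly_onto_def by simp
  qed
  with S p show "S \<in> generated_topology (Sets U) (surjective_families U) X"
    unfolding generated_topology_def by blast
qed

text \<open>The fibre product of \<open>A\<close> and \<open>B\<close> consists of pairs and is not a set of elements of the given type.
  It is carried over to a member \<open>C\<close> of the universe that is in bijection with the product of \<open>A\<close>
  and \<open>B\<close>.\<close>

lemma has_pullbacks_Sets: "has_pullbacks (Sets U)"
  unfolding has_pullbacks_def
proof (intro ballI impI)
  fix f g assume fg: "f \<in> Mor (Sets U)" "g \<in> Mor (Sets U)" "Cod (Sets U) f = Cod (Sets U) g"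
  define A B X where "A = fst f" and "B = fst g" and "X = snd (snd f)"
  have f: "f \<in> hom (Sets U) A X" and g: "g \<in> hom (Sets U) B X"
    using fg by (simp_all add: hom_def A_def B_def X_def)
  have U: "A \<in> U" "B \<in> U" using hom_SetsD(1)[OF f] hom_SetsD(1)[OF g] by auto
  then obtain C h where C: "C \<in> U" and h: "bij_betw h C (A \<times> B)"
    using Sigma_in_universe[of A "\<lambda>_. B"] by blast
  define P where "P = {c \<in> C. app f (fst (h c)) = app g (snd (h c))}"
  have P: "P \<in> U" using lepoll_closed[OF C] subset_imp_lepoll[of P C] unfolding P_def by blast
  have hP: "fst (h c) \<in> A" "snd (h c) \<in> B" "app f (fst (h c)) = app g (snd (h c))"
    if "c \<in> P" for c
    using that bij_betwE[OF h] unfolding P_def by (auto simp: mem_Times_iff)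
  define p q where "p = map_of_fun P (fst \<circ> h) A" and "q = map_of_fun P (snd \<circ> h) B"
  have p: "p \<in> hom (Sets U) P A" and q: "q \<in> hom (Sets U) P B"
    unfolding p_def q_def using P U hP by (auto intro!: hom_map_of_fun)
  have app_p: "app p c = fst (h c)" and app_q: "app q c = snd (h c)" if "c \<in> P" for c
    using that by (simp_all add: p_def q_def app_map_of_fun)
  have square: "f \<odot> p = g \<odot> q"
  proof (rule map_eqI[OF comp_hom[OF p f] comp_hom[OF q g]])
    show "app (f \<odot> p) c = app (g \<odot> q) c" if "c \<in> P" for c
      using that hP hom_SetsD(3)[OF p] hom_SetsD(3)[OF q]
      by (simp add: comp_Sets_simps app_p app_q)
  qed
  have universal: "\<exists>!u. u \<in> hom (Sets U) W P \<and> p \<odot> u = a \<and> q \<odot> u = b"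
    if W: "W \<in> U" and a: "a \<in> hom (Sets U) W A" and b: "b \<in> hom (Sets U) W B"
      and ab: "f \<odot> a = g \<odot> b" for W a b
  proof (rule ex1I)
    define k where "k w = inv_into C h (app a w, app b w)" for w
    define u where "u = map_of_fun W k P"
    have k: "k w \<in> C" "h (k w) = (app a w, app b w)" if "w \<in> W" for w
    proof -
      have "(app a w, app b w) \<in> h ` C"
        using bij_betw_imp_surj_on[OF h] hom_SetsD(5)[OF a that] hom_SetsD(5)[OF b that] by simp
      then show "k w \<in> C" "h (k w) = (app a w, app b w)"
        unfolding k_def by (rule inv_into_into, rule f_inv_into_f)
    qed
    have "app f (app a w) = app g (app b w)" if "w \<in> W" for w
      using comp_Sets_simps(3)[of w a U f] comp_Sets_simps(3)[of w b U g] that ab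
        hom_SetsD(3)[OF a] hom_SetsD(3)[OF b] by simp
    then have kP: "k w \<in> P" if "w \<in> W" for w
      using that k unfolding P_def by simp
    have u: "u \<in> hom (Sets U) W P" unfolding u_def using W P kP by (intro hom_map_of_fun)
    have app_u: "app u w = k w" if "w \<in> W" for w using that by (simp add: u_def app_map_of_fun)
    have "app (p \<odot> u) w = app a w" "app (q \<odot> u) w = app b w" if "w \<in> W" for w
      using that k kP hom_SetsD(3)[OF u] by (simp_all add: comp_Sets_simps app_u app_p app_q)
    then have "p \<odot> u = a" "q \<odot> u = b"
      using map_eqI[OF comp_hom[OF u p] a] map_eqI[OF comp_hom[OF u q] b] by blast+
    with u show "u \<in> hom (Sets U) W P \<and> p \<odot> u = a \<and> q \<odot> u = b" by blast
    fix u' assume u': "u' \<in> hom (Sets U) W P \<and> p \<odot> u' = a \<and> q \<odot> u' = b"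
    have "app u' w = app u w" if w: "w \<in> W" for w
    proof -
      have u'h: "u' \<in> hom (Sets U) W P" using u' by simp
      have P': "app u' w \<in> P" using hom_SetsD(5)[OF u'h w] .
      have "app (p \<odot> u') w = fst (h (app u' w))" "app (q \<odot> u') w = snd (h (app u' w))"
        using w P' hom_SetsD(3)[OF u'h] by (simp_all add: comp_Sets_simps app_p app_q)
      then have "h (app u' w) = h (k w)" using u' k[OF w] by (simp add: prod_eq_iff)
      then have "app u' w = k w"
        using bij_betw_imp_inj_on[OF h] P' kP[OF w] unfolding P_def inj_on_def by blast
      then show ?thesis using app_u[OF w] by simp
    qed
    then show "u' = u" using map_eqI[of u' U W P u] u u' by simp
  qed
  have "is_pullback (Sets U) f g p q"
    unfolding is_pullback_def
    using fg p q square universal hom_SetsD(3)[OF p] by (auto simp: A_def B_def)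
  then show "\<exists>p q. is_pullback (Sets U) f g p q" by blast
qed

lemma iso_in_surjective_families:
  assumes "iso (Sets U) f"
  shows "{f} \<in> surjective_families U (snd (snd f))"
proof -
  obtain g where f: "f \<in> Mor (Sets U)" and g: "g \<in> hom (Sets U) (snd (snd f)) (fst f)"
    and fg: "f \<odot> g = Id (Sets U) (snd (snd f))"
    using assms unfolding iso_def by auto
  have "app g x \<in> fst f \<and> app f (app g x) = x" if "x \<in> snd (snd f)" for x
  proof
    show "app g x \<in> fst f" using hom_SetsD(5)[OF g that] .
    have "app (f \<odot> g) x = app f (app g x)"
      using that hom_SetsD(3)[OF g] by (simp add: comp_Sets_simps)
    moreover have "app (Id (Sets U) (snd (snd f))) x = x"
      using that by (simp add: Sets_def app_def)
    ultimately show "app f (app g x) = x" using fg by simp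
  qed
  then have "jointly_onto (snd (snd f)) {f}" unfolding jointly_onto_def by blast
  then show ?thesis
    using surjective_familiesI[of "{undefined}" "\<lambda>_. f"] f finite_in_universe by simp
qed

text \<open>The universal property of the pullback, applied to points, lifts a preimage of \<open>g y\<close>
  under a member \<open>f\<close> of the family to a preimage of \<open>y\<close> under the pullback of \<open>f\<close>.\<close>

lemma pullback_in_surjective_families:
  assumes F: "F \<in> surjective_families U X" and g: "g \<in> Mor (Sets U)" "snd (snd g) = X"
    and pb: "\<And>f. f \<in> F \<Longrightarrow> is_pullback (Sets U) f g (p f) (q f)"
  shows "q ` F \<in> surjective_families U (fst g)"
proof -
  obtain I m where Im: "F = m ` I" "map_family U X I m" and onto: "jointly_onto X F"
    using F by (rule surjective_familiesE)
  have gh: "g \<in> hom (Sets U) (fst g) X" using g by (simp add: hom_def)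
  have q: "q f \<in> hom (Sets U) (fst (p f)) (fst g)" if "f \<in> F" for f
    using pb[OF that] unfolding is_pullback_def by simp
  have "\<exists>f \<in> F. \<exists>a \<in> fst (q f). app (q f) a = y" if y: "y \<in> fst g" for y
  proof -
    have "app g y \<in> X" using hom_SetsD(5)[OF gh y] .
    then obtain f a where f: "f \<in> F" "a \<in> fst f" "app f a = app g y"
      using onto unfolding jointly_onto_def by blast
    have fh: "f \<in> hom (Sets U) (fst f) X"
      using f Im unfolding map_family_def hom_def by auto
    have pa: "point (fst f) a \<in> hom (Sets U) {undefined} (fst f)"
      and py: "point (fst g) y \<in> hom (Sets U) {undefined} (fst g)"
      using point_hom f y hom_SetsD(1)[OF fh] hom_SetsD(1)[OF gh] by blast+
    have "f \<odot> point (fst f) a = g \<odot> point (fst g) y"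
      using comp_point[OF fh f(2)] comp_point[OF gh y] f(3) by simp
    then obtain u where u: "u \<in> hom (Sets U) {undefined} (fst (p f))" "q f \<odot> u = point (fst g) y"
      by (rule is_pullback_lift[OF pb[OF f(1)], unfolded Ob_Sets Dom_Sets, OF hom_SetsD(1)[OF pa] pa py])
    have "app (q f) (app u undefined) = y"
      using comp_Sets_simps(3)[of undefined u U "q f"] u hom_SetsD(3)[OF u(1)] by simp
    moreover have "app u undefined \<in> fst (q f)"
      using hom_SetsD(5)[OF u(1)] hom_SetsD(3)[OF q[OF f(1)]] by simp
    ultimately show ?thesis using f(1) by blast
  qed
  then have "jointly_onto (fst g) ((q \<circ> m) ` I)"
    unfolding jointly_onto_def using Im(1) by (auto simp: image_comp[symmetric])
  then have "(q \<circ> m) ` I \<in> surjective_families U (fst g)"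
    using Im q by (intro surjective_familiesI) (auto simp: map_family_def hom_def)
  then show ?thesis using Im(1) by (simp add: image_comp)
qed

text \<open>The composites are indexed by the disjoint union of the index sets of the inner families, for
  which the universe has a member of the same size.\<close>

lemma compositions_in_surjective_families:
  assumes F: "F \<in> surjective_families U X"
    and G: "\<And>f. f \<in> F \<Longrightarrow> G f \<in> surjective_families U (fst f)"
  shows "{f \<odot> g | f g. f \<in> F \<and> g \<in> G f} \<in> surjective_families U X"
proof -
  obtain I m where Im: "F = m ` I" "map_family U X I m" and onto: "jointly_onto X F"
    using F by (rule surjective_familiesE)
  have "\<exists>J n. G f = n ` J \<and> map_family U (fst f) J n" if "f \<in> F" for f
    using G[OF that] by (metis surjective_familiesE)
  then obtain J n where Jn: "\<And>f. f \<in> F \<Longrightarrow> G f = n f ` J f \<and> map_family U (fst f) (J f) (n f)"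
    by metis
  have "I \<in> U" "\<And>i. i \<in> I \<Longrightarrow> J (m i) \<in> U"
    using Im Jn unfolding map_family_def by blast+
  then obtain C h where C: "C \<in> U" and h: "bij_betw h C (SIGMA i:I. J (m i))"
    by (rule Sigma_in_universe)
  define k where "k c = m (fst (h c)) \<odot> n (m (fst (h c))) (snd (h c))" for c
  have F_hom: "f \<in> hom (Sets U) (fst f) X" if "f \<in> F" for f
    using that Im unfolding map_family_def hom_def by auto
  have G_hom: "g \<in> hom (Sets U) (fst g) (fst f)" if "f \<in> F" "g \<in> G f" for f g
    using that Jn[OF that(1)] unfolding map_family_def hom_def by auto
  have eq: "{f \<odot> g | f g. f \<in> F \<and> g \<in> G f} = k ` C"
  proof -
    have "k ` C = (\<lambda>(i, j). m i \<odot> n (m i) j) ` (h ` C)"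
      unfolding image_image k_def by (simp add: case_prod_beta)
    also have "\<dots> = (\<lambda>(i, j). m i \<odot> n (m i) j) ` (SIGMA i:I. J (m i))"
      using bij_betw_imp_surj_on[OF h] by simp
    also have "\<dots> = (\<Union>i \<in> I. (\<lambda>g. m i \<odot> g) ` n (m i) ` J (m i))" by force
    also have "\<dots> = (\<Union>f \<in> F. (\<lambda>g. f \<odot> g) ` G f)" using Jn Im(1) by simp
    also have "\<dots> = {f \<odot> g | f g. f \<in> F \<and> g \<in> G f}" by blast
    finally show ?thesis by simp
  qed
  have hom: "l \<in> hom (Sets U) (fst l) X" if "l \<in> {f \<odot> g | f g. f \<in> F \<and> g \<in> G f}" for l
    using that comp_hom[OF G_hom F_hom] by (auto simp: comp_Sets_simps)
  have "jointly_onto X {f \<odot> g | f g. f \<in> F \<and> g \<in> G f}"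
    unfolding jointly_onto_def
  proof
    fix x assume "x \<in> X"
    then obtain f a where f: "f \<in> F" "a \<in> fst f" "app f a = x"
      using onto unfolding jointly_onto_def by blast
    then obtain g b where g: "g \<in> G f" "b \<in> fst g" "app g b = a"
      using surjective_familiesE[OF G[OF f(1)]] unfolding jointly_onto_def by metis
    have "b \<in> fst (f \<odot> g)" "app (f \<odot> g) b = x" using f g by (simp_all add: comp_Sets_simps)
    then show "\<exists>l \<in> {f \<odot> g | f g. f \<in> F \<and> g \<in> G f}. \<exists>a \<in> fst l. app l a = x"
      using f(1) g(1) by blast
  qed
  then show ?thesis
    unfolding eq using C hom[unfolded eq] by (intro surjective_familiesI) (auto simp: hom_def)
qed

lemma grothendieck_basis_surjective_families:
  "grothendieck_basis (Sets U) (surjective_families U)"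
proof -
  have "F \<subseteq> {f \<in> Mor (Sets U). snd (snd f) = X}" if "F \<in> surjective_families U X" for F X
    using that by (rule surjective_familiesE) (auto simp: map_family_def)
  then show ?thesis
    unfolding grothendieck_basis_def Dom_Sets Cod_Sets
    by (intro conjI ballI allI impI has_pullbacks_Sets iso_in_surjective_families
        pullback_in_surjective_families compositions_in_surjective_families; blast)
qed


section \<open>The canonical topology on sets\<close>

lemma grothendieck_topology_generated:
  "grothendieck_topology (Sets U) (generated_topology (Sets U) (surjective_families U))"
  (is "grothendieck_topology _ ?J")
  unfolding grothendieck_topology_def
proof (intro conjI ballI allI impI)
  note J = generated_topology_iff
  fix X assume "X \<in> Ob (Sets U)"
  then have X: "X \<in> U" by simp
  show "sieve (Sets U) X S" if "S \<in> ?J X" for S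
    using that J[OF X] by blast
  have max: "sieve (Sets U) X {f \<in> Mor (Sets U). Cod (Sets U) f = X}"
    using comp_hom unfolding sieve_def by (auto simp: Mor_Sets_iff comp_Sets_simps)
  moreover have "jointly_onto X {f \<in> Mor (Sets U). Cod (Sets U) f = X}"
    using point_hom[OF X] unfolding jointly_onto_sieve_iff[OF max] by (simp add: hom_def)
  ultimately show "{f \<in> Mor (Sets U). Cod (Sets U) f = X} \<in> ?J X" using J[OF X] by blast
  show "pullback_sieve (Sets U) h S \<in> ?J (Dom (Sets U) h)"
    if S: "S \<in> ?J X" and h: "h \<in> Mor (Sets U)" "Cod (Sets U) h = X" for S h
  proof -
    have "fst h \<in> U" using h(1) hom_SetsD(1) unfolding Mor_Sets_iff by blast
    then show ?thesis
      using S h J[OF X] J sieve_pullback jointly_onto_pullback unfolding Dom_Sets Cod_Sets by blast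
  qed
  fix S R assume S: "S \<in> ?J X" and R: "sieve (Sets U) X R"
    and local: "\<forall>h \<in> S. pullback_sieve (Sets U) h R \<in> ?J (Dom (Sets U) h)"
  have "jointly_onto X R"
    unfolding jointly_onto_def
  proof
    fix x assume "x \<in> X"
    then obtain h a where h: "h \<in> S" "a \<in> fst h" "app h a = x"
      using S J[OF X] unfolding jointly_onto_def by blast
    have "fst h \<in> U" using S J[OF X] sieve_homD h(1) hom_SetsD(1) by blast
    then have "jointly_onto (fst h) (pullback_sieve (Sets U) h R)"
      using local h(1) J unfolding Dom_Sets by blast
    then obtain f b where f: "f \<in> pullback_sieve (Sets U) h R" "b \<in> fst f" "app f b = a"
      using h(2) unfolding jointly_onto_def by blast
    then have "h \<odot> f \<in> R" "b \<in> fst (h \<odot> f)" "app (h \<odot> f) b = x"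
      using h by (simp_all add: pullback_sieve_def comp_Sets_simps)
    then show "\<exists>f \<in> R. \<exists>a \<in> fst f. app f a = x" by blast
  qed
  then show "R \<in> ?J X" using R J[OF X] by blast
qed

lemma is_canonical_topology_generated:
  "is_canonical_topology (Sets U) (generated_topology (Sets U) (surjective_families U))"
  unfolding is_canonical_topology_def representables_are_sheaves_iff[OF category_Sets]
proof (intro conjI allI impI ballI)
  show "grothendieck_topology (Sets U) (generated_topology (Sets U) (surjective_families U))"
    by (rule grothendieck_topology_generated)
next
  fix X S assume "X \<in> Ob (Sets U)" "S \<in> generated_topology (Sets U) (surjective_families U) X"
  then show "unique_amalgamation (Sets U) X S"
    using generated_topology_iff unique_amalgamation_if_jointly_onto by simp
next
  fix J X assume J: "grothendieck_topology (Sets U) J \<and>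
      (\<forall>X \<in> Ob (Sets U). \<forall>S \<in> J X. unique_amalgamation (Sets U) X S)"
    and X: "X \<in> Ob (Sets U)"
  show "J X \<subseteq> generated_topology (Sets U) (surjective_families U) X"
  proof
    fix S assume "S \<in> J X"
    have "\<forall>X \<in> Ob (Sets U). \<forall>S \<in> J X. sieve (Sets U) X S"
      using J unfolding grothendieck_topology_def by (elim conjE)
    then have "sieve (Sets U) X S" using X \<open>S \<in> J X\<close> by simp
    moreover have "unique_amalgamation (Sets U) X S" using J X \<open>S \<in> J X\<close> by simp
    ultimately show "S \<in> generated_topology (Sets U) (surjective_families U) X"
      using X generated_topology_iff jointly_onto_if_unique_amalgamation by simp
  qed
qed

lemma sieve_generated_sieve:
  assumes "F \<subseteq> {f \<in> Mor (Sets U). snd (snd f) = X}"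
  shows "sieve (Sets U) X (generated_sieve (Sets U) F)"
  unfolding sieve_def
proof (intro conjI ballI impI)
  show "generated_sieve (Sets U) F \<subseteq> {f \<in> Mor (Sets U). Cod (Sets U) f = X}"
  proof
    fix k assume "k \<in> generated_sieve (Sets U) F"
    then obtain f g where f: "f \<in> F" and g: "g \<in> Mor (Sets U)" "snd (snd g) = fst f"
      and k: "k = f \<odot> g"
      unfolding generated_sieve_def by auto
    have "f \<in> hom (Sets U) (fst f) X" "g \<in> hom (Sets U) (fst g) (fst f)"
      using assms f g by (auto simp: hom_def)
    then have "k \<in> hom (Sets U) (fst g) X" unfolding k by (rule comp_hom[rotated])
    then show "k \<in> {f \<in> Mor (Sets U). Cod (Sets U) f = X}" by (simp add: hom_def)
  qed
next
  fix k l assume "k \<in> generated_sieve (Sets U) F" and l: "l \<in> Mor (Sets U)"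
    "Cod (Sets U) l = Dom (Sets U) k"
  then obtain f g where f: "f \<in> F" and g: "g \<in> Mor (Sets U)" "snd (snd g) = fst f"
    and k: "k = f \<odot> g"
    unfolding generated_sieve_def by auto
  have fh: "f \<in> hom (Sets U) (fst f) X" and gh: "g \<in> hom (Sets U) (fst g) (fst f)"
    and lh: "l \<in> hom (Sets U) (fst l) (fst g)"
    using assms f g l by (auto simp: hom_def k comp_Sets_simps)
  have "k \<odot> l = f \<odot> (g \<odot> l)" using category_assocD[OF category_Sets lh gh fh] k by simp
  moreover have "g \<odot> l \<in> hom (Sets U) (fst l) (fst f)" using comp_hom[OF lh gh] .
  ultimately show "k \<odot> l \<in> generated_sieve (Sets U) F"
    using f unfolding generated_sieve_def hom_def Dom_Sets Cod_Sets by blast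
qed

lemma jointly_onto_generated_sieve_iff:
  assumes F: "F \<subseteq> {f \<in> Mor (Sets U). snd (snd f) = X}"
  shows "jointly_onto X (generated_sieve (Sets U) F) \<longleftrightarrow> jointly_onto X F"
proof
  assume onto: "jointly_onto X (generated_sieve (Sets U) F)"
  show "jointly_onto X F"
    unfolding jointly_onto_def
  proof
    fix x assume "x \<in> X"
    then obtain f g a where f: "f \<in> F" and g: "g \<in> Mor (Sets U)" "snd (snd g) = fst f"
      and a: "a \<in> fst (f \<odot> g)" "app (f \<odot> g) a = x"
      using onto unfolding jointly_onto_def generated_sieve_def Dom_Sets Cod_Sets by blast
    then have "app g a \<in> fst f" "app f (app g a) = x"
      by (auto simp: comp_Sets_simps Mor_Sets_iff hom_SetsD(5))
    then show "\<exists>f \<in> F. \<exists>a \<in> fst f. app f a = x" using f by blast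
  qed
next
  assume "jointly_onto X F"
  moreover have "F \<subseteq> generated_sieve (Sets U) F"
  proof
    fix f assume f: "f \<in> F"
    then have fh: "f \<in> hom (Sets U) (fst f) X" using F by (auto simp: hom_def)
    have "f = f \<odot> Id (Sets U) (fst f)" using category_idD(1)[OF category_Sets fh] by simp
    moreover have "Id (Sets U) (fst f) \<in> hom (Sets U) (fst f) (fst f)"
      using category_id_hom[OF category_Sets] hom_SetsD(1)[OF fh] by simp
    ultimately show "f \<in> generated_sieve (Sets U) F"
      using f unfolding generated_sieve_def hom_def Dom_Sets Cod_Sets by blast
  qed
  ultimately show "jointly_onto X (generated_sieve (Sets U) F)" by (rule jointly_onto_mono)
qed

text \<open>Two canonical topologies contain each other, so \<open>J\<close> has the covering sieves of the generated
  topology.\<close>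

lemma canonical_topology_generated_sieve_iff:
  assumes J: "is_canonical_topology (Sets U) J" and X: "X \<in> U" and f: "map_family U X I f"
  shows "generated_sieve (Sets U) (f ` I) \<in> J X \<longleftrightarrow> induced_map f ` coproduct_dom I f = X"
proof -
  have "J X = generated_topology (Sets U) (surjective_families U) X"
    using J is_canonical_topology_generated X unfolding is_canonical_topology_def Ob_Sets
    by (intro equalityI) blast+
  moreover have "f ` I \<subseteq> {g \<in> Mor (Sets U). snd (snd g) = X}"
    using f unfolding map_family_def by auto
  ultimately show ?thesis
    using generated_topology_iff[OF X] sieve_generated_sieve jointly_onto_generated_sieve_iff
      jointly_onto_image_iff[OF f] by simp
qed

end

theorem proposition4p4:
  fixes U :: "'u set set"
  assumes "set_universe U"
  shows "grothendieck_basis (Sets U) (surjective_families U) \<and>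
    is_canonical_topology (Sets U) (generated_topology (Sets U) (surjective_families U)) \<and>
    (\<forall>J X I f. is_canonical_topology (Sets U) J \<longrightarrow> X \<in> U \<longrightarrow> map_family U X I f \<longrightarrow>
       (generated_sieve (Sets U) (f ` I) \<in> J X \<longleftrightarrow>
        induced_map f ` coproduct_dom I f = X)) \<and>
    (\<forall>X S. X \<in> U \<longrightarrow> colim_sieve (Sets U) X S \<longrightarrow> universal_colim_sieve (Sets U) X S)"
proof -
  interpret universe U by unfold_locales (rule assms)
  show ?thesis
    using grothendieck_basis_surjective_families is_canonical_topology_generated
      canonical_topology_generated_sieve_iff universal_if_colim_sieve by blast
qed

end
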